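(* Let $(X,d)$ be a separable metric space which is directionally $(\xi,\eta,\zeta)$-limited at $X$ and endowed with an asymptotically $(\alpha,\gamma)$-bounded measure $\nu$, for some constants $\alpha\in(0,1]$ and $\gamma\ge1$. Let $\mu$ be a positive Borel measure on $X$. Fix $\epsilon_0>0$ and for any $\delta>0$ define $$\mathcal F_\delta=\{B=B_r(x)\text{ closed ball}\subset X:\ \mu(B)\le(\gamma+\epsilon_0)\,\mu(B_{\alpha r}(x))\text{ and }\operatorname{diam}B\le2\delta\}$$ and, for any $A\subset X$, $$\mathcal F_\delta^A=\{B\in\mathcal F_\delta:\ B=B_r(a),\ a\in A\}.$$ Then there exist $A_0\subset X$ and $2\zeta+1$ countable subfamilies $\mathcal G_1,\dots,\mathcal G_{2\zeta+1}$ of $\mathcal F_\delta^A$, each consisting of pairwise disjoint closed balls, such that $$A\subset A_0\cup\bigcup_{j=1}^{2\zeta+1}\bigsqcup_{B\in\mathcal G_j}B\quad\text{and}\quad\mu(A_0)=0.$$ Moreover, if $\mu(A)<+\infty$, then for any open set $U\subset X$ there exists a countable collection $\mathcal G$ of pairwise disjoint balls in $\mathcal F_\delta^A$ such that $$\bigsqcup_{B\in\mathcal G}B\subset U\quad\text{and}\quad\mu\Big((A\cap U)\setminus\bigsqcup_{B\in\mathcal G}B\Big)=0.$$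
   Context: Balls: $B_r(x)=\{y\in X: d(x,y)\le r\}$ is the closed ball and $U_r(x)=\{y\in X: d(x,y)<r\}$ the open ball, $r>0$. In the definition of $\mathcal F_\delta$ and $\mathcal F_\delta^A$ a ball is considered together with its center and radius. If a set is not Borel, its $\mu$-measure is understood as the outer measure $\inf\{\mu(B):B\text{ Borel containing the set}\}$. Directionally limited: let $\xi>0$, $0<\eta\le\frac13$, $\zeta\in\{1,2,\dots\}$ and $A\subset X$. The distance $d$ is directionally $(\xi,\eta,\zeta)$-limited at $A$ if, for every $a\in A$ and every $B\subset A\cap(U_\xi(a)\setminus\{a\})$ with the property that for all $b,c\in B$ with $b\ne c$ and $d(a,b)\ge d(a,c)$ and all $x\in X$ with $d(a,x)=d(a,c)$ and $d(a,x)+d(x,b)=d(a,b)$ one has $\frac{d(x,c)}{d(a,c)}\ge\eta$, it holds that $\operatorname{card}B\le\zeta$. Asymptotically $(\alpha,\gamma)$-bounded measure: a positive Borel measure $\nu$ on $X$ that is finite on bounded sets, strictly positive on every ball of positive radius, and such that $\limsup_{r\to0^+}\frac{\nu(B_r(x))}{\nu(B_{\alpha r}(x))}\le\gamma$ for all $x\in X$. *)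

theory Defs
  imports "HOL-Analysis.Analysis"
begin

text \<open>
  A measure whose sigma-algebra is the Borel one gives the junk value 0 to a non-Borel set under
  \<^const>\<open>emeasure\<close>. The measure of an arbitrary set is therefore always written
  \<^const>\<open>outer_measure_of\<close>, which is the infimum over the Borel supersets.
\<close>

definition borel_measure :: "'a::topological_space measure \<Rightarrow> bool"
  where "borel_measure M \<longleftrightarrow> sets M = sets borel"

text \<open>
  The range of the constants (\<open>0 < \<xi>\<close>, \<open>0 < \<eta> \<le> 1/3\<close>, \<open>1 \<le> \<zeta>\<close>) is not part of this predicate.
\<close>

definition directionally_limited_at ::
  "real \<Rightarrow> real \<Rightarrow> nat \<Rightarrow> 'a::metric_space set \<Rightarrow> bool"
  where "directionally_limited_at \<xi> \<eta> \<zeta> A \<longleftrightarrow>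
    (\<forall>a\<in>A. \<forall>B \<subseteq> A \<inter> (ball a \<xi> - {a}).
      (\<forall>b\<in>B. \<forall>c\<in>B. b \<noteq> c \<and> dist a b \<ge> dist a c \<longrightarrow>
        (\<forall>x. dist a x = dist a c \<and> dist a x + dist x b = dist a b \<longrightarrow>
          dist x c / dist a c \<ge> \<eta>))
      \<longrightarrow> finite B \<and> card B \<le> \<zeta>)"

definition asymptotically_bounded ::
  "real \<Rightarrow> real \<Rightarrow> 'a::metric_space measure \<Rightarrow> bool"
  where "asymptotically_bounded \<alpha> \<gamma> \<nu> \<longleftrightarrow>
    borel_measure \<nu> \<and>
    (\<forall>S\<in>sets borel. bounded S \<longrightarrow> emeasure \<nu> S < \<infinity>) \<and>
    (\<forall>x. \<forall>r>0. emeasure \<nu> (cball x r) > 0) \<and>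
    (\<forall>x. Limsup (at_right 0)
            (\<lambda>r. emeasure \<nu> (cball x r) / emeasure \<nu> (cball x (\<alpha> * r))) \<le> ennreal \<gamma>)"

text \<open>
  A ball is considered together with its center and radius, which the point set does not
  determine in a general metric space; families of closed balls are thus sets of pairs
  \<open>(x, r)\<close> standing for \<open>cball x r\<close>.
\<close>

abbreviation closed_ball :: "'a::metric_space \<times> real \<Rightarrow> 'a set"
  where "closed_ball \<equiv> \<lambda>(x, r). cball x r"

text \<open>In \<open>\<F> \<mu> \<alpha> C \<delta>\<close> the parameter \<open>C\<close> plays the role of \<open>\<gamma> + \<epsilon>\<^sub>0\<close>.\<close>

definition ball_family ::
  "'a::metric_space measure \<Rightarrow> real \<Rightarrow> real \<Rightarrow> real \<Rightarrow> ('a \<times> real) set"  ("\<F>")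
  where "\<F> \<mu> \<alpha> C \<delta> =
    {(x, r). r > 0 \<and>
       emeasure \<mu> (cball x r) \<le> ennreal C * emeasure \<mu> (cball x (\<alpha> * r)) \<and>
       diameter (cball x r) \<le> 2 * \<delta>}"

definition centered_ball_family ::
  "'a::metric_space measure \<Rightarrow> real \<Rightarrow> real \<Rightarrow> real \<Rightarrow> 'a set \<Rightarrow> ('a \<times> real) set"  ("\<F>\<^sub>A")
  where "\<F>\<^sub>A \<mu> \<alpha> C \<delta> A = {(a, r) \<in> \<F> \<mu> \<alpha> C \<delta>. a \<in> A}"

end

theory Submission
  imports Defs
begin

text \<open>
  From every point of a set one ball is selected, greedily and in order of roughly decreasing radii,
  keeping a ball only if its centre is not covered yet. Directional limitedness bounds by \<open>2 * \<zeta>\<close> the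
  number of earlier selected balls that a given one meets, so the selected balls can be coloured with
  \<open>2 * \<zeta> + 1\<close> colours such that balls of the same colour are disjoint. The points at which
  \<open>\<F> \<mu> \<alpha> C \<delta>\<close> has no arbitrarily small balls are \<open>\<mu>\<close>-null: there \<open>\<mu>\<close> of a ball decays faster than \<open>\<nu>\<close> of it,
  so these points are covered by balls with \<open>\<mu>\<close>-measure at most \<open>\<epsilon>\<close> times their \<open>\<nu>\<close>-measure. For the second
  claim, one colour captures at least a \<open>1 / (2 * \<zeta> + 1)\<close> part of the measure, hence finitely many of its
  balls capture a fixed fraction; what they leave of the open set is open again, and one iterates.
\<close>

section \<open>Selection and colouring along well-founded relations\<close>

text \<open>Well-founded recursion decides \<open>a\<close> from the members earlier than
  \<open>a\<close>, so the greedy selection may run through uncountably many points.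
  \<open>P b a\<close> will mean that the ball at \<open>b\<close> covers the point
  \<open>a\<close>.\<close>

lemma wf_kernel_exists:
  assumes "wf R"
  shows "\<exists>S\<subseteq>A. \<forall>a\<in>A. a \<in> S \<longleftrightarrow> (\<forall>b\<in>S. (b, a) \<in> R \<longrightarrow> \<not> P b a)"
proof -
  define f where "f = wfrec R (\<lambda>f a. a \<in> A \<and> (\<forall>b. (b, a) \<in> R \<and> f b \<longrightarrow> \<not> P b a))"
  have "f a \<longleftrightarrow> a \<in> A \<and> (\<forall>b. (b, a) \<in> R \<and> cut f R a b \<longrightarrow> \<not> P b a)" for a
    unfolding f_def by (rule wfrec[OF \<open>wf R\<close>])
  then have f: "f a \<longleftrightarrow> a \<in> A \<and> (\<forall>b. (b, a) \<in> R \<and> f b \<longrightarrow> \<not> P b a)" for a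
    by (metis cut_apply)
  show ?thesis
  proof (intro exI[of _ "{a. f a}"] conjI ballI subsetI)
    show "a \<in> A" if "a \<in> {a. f a}" for a
      using that f[of a] by blast
    show "a \<in> {a. f a} \<longleftrightarrow> (\<forall>b\<in>{a. f a}. (b, a) \<in> R \<longrightarrow> \<not> P b a)" if "a \<in> A" for a
      using that f[of a] by blast
  qed
qed

text \<open>Each element takes the least colour free among its earlier neighbours; at most
  \<open>N\<close> of them cannot occupy all of \<open>{..N}\<close>. Every conflict is settled at
  the later of the two elements.\<close>

lemma wf_greedy_colouring:
  fixes E :: "'a \<Rightarrow> 'a \<Rightarrow> bool"
  assumes "wf R"
    and bound: "\<And>a. a \<in> S \<Longrightarrow> finite {b\<in>S. (b, a) \<in> R \<and> E b a} \<and> card {b\<in>S. (b, a) \<in> R \<and> E b a} \<le> N"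
  shows "\<exists>c :: 'a \<Rightarrow> nat. (\<forall>a\<in>S. c a \<le> N) \<and>
    (\<forall>a\<in>S. \<forall>b\<in>S. (b, a) \<in> R \<longrightarrow> E b a \<longrightarrow> c b \<noteq> c a)"
proof -
  define nb where "nb a = {b\<in>S. (b, a) \<in> R \<and> E b a}" for a
  define c :: "'a \<Rightarrow> nat" where "c = wfrec R (\<lambda>f a. LEAST n. n \<notin> f ` nb a)"
  have c: "c a = (LEAST n. n \<notin> c ` nb a)" for a
  proof -
    have "c a = (LEAST n. n \<notin> cut c R a ` nb a)"
      unfolding c_def by (rule wfrec[OF \<open>wf R\<close>])
    also have "cut c R a ` nb a = c ` nb a"
      by (rule image_cong) (auto simp: nb_def cut_apply)
    finally show ?thesis .
  qed
  have free: "\<exists>n\<le>N. n \<notin> c ` nb a" if "a \<in> S" for a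
  proof (rule ccontr)
    assume "\<not> ?thesis"
    then have "{..N} \<subseteq> c ` nb a" by auto
    moreover have fin: "finite (nb a)" "card (nb a) \<le> N" using bound[OF that] by (auto simp: nb_def)
    ultimately have "card {..N} \<le> card (nb a)"
      by (meson surj_card_le)
    with fin show False by simp
  qed
  show ?thesis
  proof (intro exI[of _ c] conjI ballI impI)
    fix a assume "a \<in> S"
    from free[OF this] obtain n where "n \<le> N" and n: "n \<notin> c ` nb a" by blast
    moreover have "c a \<le> n"
      unfolding c[of a] using n by (rule Least_le)
    ultimately show "c a \<le> N" by simp
  next
    fix a b assume ab: "a \<in> S" "b \<in> S" "(b, a) \<in> R" "E b a"
    from free[OF ab(1)] obtain n where "n \<notin> c ` nb a" by blast
    then have "c a \<notin> c ` nb a"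
      unfolding c[of a] by (rule LeastI)
    moreover have "b \<in> nb a" using ab by (simp add: nb_def)
    ultimately show "c b \<noteq> c a" by (metis imageI)
  qed
qed

text \<open>Radii need not be well-ordered by decreasing size. Only an integer grade is respected,
  and ties are broken by an arbitrary well-order of the type.\<close>

lemma graded_well_order_exists:
  fixes g :: "'a \<Rightarrow> nat"
  shows "\<exists>R. wf R \<and> total R \<and> (\<forall>(a, b)\<in>R. g a \<le> g b)"
proof -
  obtain r :: "'a rel" where r: "Well_order r" "Field r = UNIV"
    using well_ordering by (elim exE conjE) (rule that)
  then have wf: "wf (r - Id)" and tot: "total r"
    by (simp_all add: well_order_on_def linear_order_on_def)
  define R where "R = inv_image (less_than <*lex*> (r - Id)) (\<lambda>a. (g a, a))"
  show ?thesis
  proof (intro exI[of _ R] conjI)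
    show "wf R" unfolding R_def by (intro wf_inv_image wf_lex_prod wf_less_than wf)
    show "total R"
    proof (rule total_onI)
      fix a b :: 'a assume "a \<noteq> b"
      then have "(a, b) \<in> r - Id \<or> (b, a) \<in> r - Id" using tot by (simp add: total_on_def)
      then show "(a, b) \<in> R \<or> (b, a) \<in> R"
        unfolding R_def in_inv_image in_lex_prod less_than_iff by linarith
    qed
    show "\<forall>(a, b)\<in>R. g a \<le> g b" by (auto simp: R_def)
  qed
qed

section \<open>The covering theorem of Besicovitch and Federer\<close>

text \<open>
  The neighbours \<open>b\<close> of a ball \<open>cball a (\<rho> a)\<close> are split at distance \<open>8/5 * \<rho> a\<close> from \<open>a\<close>. Within each
  part, directions are separated by at least \<open>1/3\<close>, for different reasons: the near centres are
  apart from each other by about \<open>\<rho> a\<close> while their distances to \<open>a\<close> differ by little; for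
  the far ones \<open>\<rho> a\<close> is small compared to the distances. The ratio \<open>25/24\<close> is small enough for both.
\<close>

lemma card_neighbours_le:
  fixes a :: "'a::metric_space" and \<rho> :: "'a \<Rightarrow> real"
  assumes dl: "directionally_limited_at \<xi> \<eta> \<zeta> (UNIV :: 'a set)" and "\<eta> \<le> 1 / 3" and "0 < \<rho> a"
    and I: "\<And>b. b \<in> I \<Longrightarrow> \<rho> b < dist a b \<and> dist a b \<le> \<rho> a + \<rho> b \<and> \<rho> a \<le> 25 / 24 * \<rho> b \<and> dist a b < \<xi>"
    and sep: "\<And>b c. b \<in> I \<Longrightarrow> c \<in> I \<Longrightarrow> b \<noteq> c \<Longrightarrow>
      (\<rho> b < dist b c \<and> \<rho> c \<le> 25 / 24 * \<rho> b) \<or> (\<rho> c < dist b c \<and> \<rho> b \<le> 25 / 24 * \<rho> c)"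
  shows "finite I \<and> card I \<le> 2 * \<zeta>"
proof -
  define near where "near = {b\<in>I. dist a b \<le> 8 / 5 * \<rho> a}"
  define far where "far = {b\<in>I. dist a b > 8 / 5 * \<rho> a}"
  have pos: "0 < \<rho> b" if "b \<in> I" for b
    using I[OF that] \<open>0 < \<rho> a\<close> by linarith
  \<comment> \<open>Of the condition that \<open>x\<close> lies between \<open>a\<close> and
    \<open>b\<close> only the length of the piece from \<open>x\<close> to \<open>b\<close> is kept;
    the bound 1/3 implies the one with \<eta>.\<close>
  have limited: "finite J \<and> card J \<le> \<zeta>"
    if J: "J \<subseteq> I"
      and dir: "\<And>b c x. b \<in> J \<Longrightarrow> c \<in> J \<Longrightarrow> b \<noteq> c \<Longrightarrow> dist a c \<le> dist a b \<Longrightarrow>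
        dist x b = dist a b - dist a c \<Longrightarrow> dist a c / 3 \<le> dist x c" for J
  proof -
    have "J \<subseteq> UNIV \<inter> (ball a \<xi> - {a})"
      using I pos J by fastforce
    moreover have "\<forall>b\<in>J. \<forall>c\<in>J. b \<noteq> c \<and> dist a c \<le> dist a b \<longrightarrow>
        (\<forall>x. dist a x = dist a c \<and> dist a x + dist x b = dist a b \<longrightarrow> \<eta> \<le> dist x c / dist a c)"
    proof (intro ballI allI impI)
      fix b c x
      assume that: "b \<in> J" "c \<in> J" "b \<noteq> c \<and> dist a c \<le> dist a b" "dist a x = dist a c \<and> dist a x + dist x b = dist a b"
      have "0 < dist a c" using that J I pos by fastforce
      moreover have "dist a c / 3 \<le> dist x c" using that by (intro dir) auto
      ultimately have "1 / 3 \<le> dist x c / dist a c" by (simp add: field_simps)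
      with \<open>\<eta> \<le> 1 / 3\<close> show "\<eta> \<le> dist x c / dist a c" by linarith
    qed
    ultimately show ?thesis
      using dl[unfolded directionally_limited_at_def, rule_format, of a J] by simp
  qed
  have tri: "dist b c \<le> dist x b + dist x c" for b c x :: 'a
    by (metis dist_commute dist_triangle)
  have near: "finite near \<and> card near \<le> \<zeta>"
  proof (rule limited)
    fix b c x assume bc: "b \<in> near" "c \<in> near" "b \<noteq> c" "dist a c \<le> dist a b"
      and x: "dist x b = dist a b - dist a c"
    then have "b \<in> I" "c \<in> I" "dist a b \<le> 8 / 5 * \<rho> a" by (auto simp: near_def)
    \<comment> \<open>In units of \<open>\<rho> a\<close>: \<open>dist b c > 24/25\<close> and
      \<open>dist a b \<le> 8/5\<close> give \<open>dist x c > dist a c - 16/25\<close>, and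
      \<open>16/25\<close> is two thirds of \<open>24/25 < dist a c\<close>.\<close>
    then show "dist a c / 3 \<le> dist x c"
      using I[of b] I[of c] sep[of b c] bc x tri[of b c x] by linarith
  qed (auto simp: near_def)
  have far: "finite far \<and> card far \<le> \<zeta>"
  proof (rule limited)
    fix b c x assume bc: "b \<in> far" "c \<in> far" "b \<noteq> c" "dist a c \<le> dist a b"
      and x: "dist x b = dist a b - dist a c"
    then have "b \<in> I" "c \<in> I" "dist a c > 8 / 5 * \<rho> a" by (auto simp: far_def)
    \<comment> \<open>In the same units, the worse alternative of \<open>sep\<close> gives
      \<open>dist x c > dist a c - 1 - \<rho> c / 24\<close>. Since
      \<open>\<rho> c < dist a c\<close>, this suffices once \<open>dist a c \<ge> 8/5\<close>,
      which is where the cut comes from.\<close>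
    then show "dist a c / 3 \<le> dist x c"
      using I[of b] I[of c] sep[of b c] bc x tri[of b c x] by linarith
  qed (auto simp: far_def)
  have "I = near \<union> far" by (auto simp: near_def far_def)
  with near far show ?thesis
    using card_Un_le[of near far] by auto
qed

text \<open>Every ball contains a point of a countable dense set, and disjointness makes the choice
  of such a point injective.\<close>

lemma countable_disjoint_balls:
  fixes G :: "'a::metric_space set"
  assumes sep: "separable_space (euclidean :: 'a topology)"
    and pos: "\<And>a. a \<in> G \<Longrightarrow> 0 < \<rho> a"
    and disj: "disjoint_family_on (\<lambda>a. cball a (\<rho> a)) G"
  shows "countable G"
proof -
  obtain C :: "'a set" where "countable C" and C: "closure C = UNIV"
    using sep by (auto simp: separable_space_def)
  have "\<exists>x\<in>C. x \<in> cball a (\<rho> a)" if "a \<in> G" for a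
    using C pos[OF that] closure_approachable[of a C] by (force simp: dist_commute)
  then obtain f where f: "\<And>a. a \<in> G \<Longrightarrow> f a \<in> C \<and> f a \<in> cball a (\<rho> a)" by metis
  have "inj_on f G"
    using f disj unfolding inj_on_def disjoint_family_on_def by (metis IntI empty_iff)
  moreover have "countable (f ` G)"
    using f \<open>countable C\<close> by (blast intro: countable_subset)
  ultimately show ?thesis by (rule countable_image_inj_on[rotated])
qed

text \<open>A point fails to be selected only if an earlier selected ball covers it, so the selected
  balls cover \<open>A\<close>. Radii below \<xi>/2 keep the centres of intersecting balls within
  \<xi> of each other, where directional limitedness applies.\<close>

theorem besicovitch_covering:
  fixes A :: "'a::metric_space set" and \<rho> :: "'a \<Rightarrow> real"
  assumes sep: "separable_space (euclidean :: 'a topology)"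
    and dl: "directionally_limited_at \<xi> \<eta> \<zeta> (UNIV :: 'a set)" and "\<eta> \<le> 1 / 3"
    and \<rho>: "\<And>a. a \<in> A \<Longrightarrow> 0 < \<rho> a \<and> \<rho> a < \<xi> / 2"
  shows "\<exists>G :: nat \<Rightarrow> 'a set.
    (\<forall>j. G j \<subseteq> A \<and> countable (G j) \<and> disjoint_family_on (\<lambda>a. cball a (\<rho> a)) (G j)) \<and>
    A \<subseteq> (\<Union>j\<in>{1..2 * \<zeta> + 1}. \<Union>a\<in>G j. cball a (\<rho> a))"
proof -
  \<comment> \<open>Generations are the geometric scales of ratio 25/24 below \<xi>/2, so a radius
    exceeds one of the same or an earlier generation at most by that factor. The logarithm is
    positive, hence \<open>nat\<close> does not truncate.\<close>
  define gen where "gen a = nat \<lfloor>log (25 / 24) ((\<xi> / 2) / \<rho> a)\<rfloor>" for a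
  have gen: "\<rho> b \<le> 25 / 24 * \<rho> a" if "a \<in> A" "b \<in> A" "gen a \<le> gen b" for a b
  proof -
    define L where "L x = log (25 / 24) ((\<xi> / 2) / \<rho> x)" for x
    have L: "0 \<le> L x" "(\<xi> / 2) / \<rho> x = (25 / 24) powr L x" if "x \<in> A" for x
    proof -
      have "1 < (\<xi> / 2) / \<rho> x" using \<rho>[OF that] by (simp add: field_simps)
      then show "0 \<le> L x" "(\<xi> / 2) / \<rho> x = (25 / 24) powr L x"
        unfolding L_def by auto
    qed
    have "L a - 1 \<le> L b"
    proof -
      have "nat \<lfloor>L a\<rfloor> \<le> nat \<lfloor>L b\<rfloor>" using that by (simp add: gen_def L_def)
      then have "\<lfloor>L a\<rfloor> \<le> \<lfloor>L b\<rfloor>" using L(1)[OF \<open>a \<in> A\<close>] L(1)[OF \<open>b \<in> A\<close>] by linarith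
      then show ?thesis by linarith
    qed
    then have "(25 / 24 :: real) powr (L a - 1) \<le> (25 / 24) powr L b" by (intro powr_mono) auto
    then have "((\<xi> / 2) / \<rho> a) / (25 / 24) \<le> (\<xi> / 2) / \<rho> b"
      using L(2)[OF \<open>a \<in> A\<close>] L(2)[OF \<open>b \<in> A\<close>] by (simp add: powr_diff)
    then have "\<xi> * (\<rho> b * 24) \<le> \<xi> * (25 * \<rho> a)"
      using \<rho>[OF \<open>a \<in> A\<close>] \<rho>[OF \<open>b \<in> A\<close>] by (simp add: field_simps)
    moreover have "0 < \<xi>" using \<rho>[OF \<open>a \<in> A\<close>] by linarith
    ultimately show ?thesis by simp
  qed
  obtain R where "wf R" "total R" and gen_mono: "\<forall>(a, b)\<in>R. gen a \<le> gen b"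
    using graded_well_order_exists[of gen] by blast
  then have total: "(a, b) \<in> R \<or> (b, a) \<in> R" if "a \<noteq> b" for a b
    using that by (auto simp: total_on_def)
  obtain S where "S \<subseteq> A" and S: "\<forall>a\<in>A. a \<in> S \<longleftrightarrow> (\<forall>b\<in>S. (b, a) \<in> R \<longrightarrow> a \<notin> cball b (\<rho> b))"
    using wf_kernel_exists[OF \<open>wf R\<close>, of A "\<lambda>b a. a \<in> cball b (\<rho> b)"] by (elim exE conjE) (rule that)
  have earlier: "\<rho> b < dist a b \<and> \<rho> a \<le> 25 / 24 * \<rho> b" if "a \<in> S" "b \<in> S" "(b, a) \<in> R" for a b
  proof
    show "\<rho> b < dist a b"
      using S that \<open>S \<subseteq> A\<close> by (force simp: dist_commute)
    show "\<rho> a \<le> 25 / 24 * \<rho> b"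
      using gen[of b a] gen_mono that \<open>S \<subseteq> A\<close> by auto
  qed
  define E where "E b a \<longleftrightarrow> cball b (\<rho> b) \<inter> cball a (\<rho> a) \<noteq> {}" for a b
  have nb: "finite {b\<in>S. (b, a) \<in> R \<and> E b a} \<and> card {b\<in>S. (b, a) \<in> R \<and> E b a} \<le> 2 * \<zeta>"
    if "a \<in> S" for a
  proof (rule card_neighbours_le[OF dl \<open>\<eta> \<le> 1 / 3\<close>])
    show "0 < \<rho> a" using \<rho> that \<open>S \<subseteq> A\<close> by blast
    fix b assume b: "b \<in> {b\<in>S. (b, a) \<in> R \<and> E b a}"
    then have "\<rho> b < dist a b \<and> \<rho> a \<le> 25 / 24 * \<rho> b" using earlier that by blast
    moreover have "dist a b \<le> \<rho> a + \<rho> b"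
    proof -
      obtain z where "dist b z \<le> \<rho> b" "dist a z \<le> \<rho> a" using b by (auto simp: E_def)
      then show ?thesis using dist_triangle[of a b z] by (simp add: dist_commute)
    qed
    moreover have "\<rho> a < \<xi> / 2" "\<rho> b < \<xi> / 2" using \<rho> that b \<open>S \<subseteq> A\<close> by auto
    ultimately show "\<rho> b < dist a b \<and> dist a b \<le> \<rho> a + \<rho> b \<and> \<rho> a \<le> 25 / 24 * \<rho> b \<and> dist a b < \<xi>"
      by linarith
  next
    fix b c assume "b \<in> {b\<in>S. (b, a) \<in> R \<and> E b a}" "c \<in> {b\<in>S. (b, a) \<in> R \<and> E b a}" "b \<noteq> c"
    then show "(\<rho> b < dist b c \<and> \<rho> c \<le> 25 / 24 * \<rho> b) \<or> (\<rho> c < dist b c \<and> \<rho> b \<le> 25 / 24 * \<rho> c)"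
      using earlier[of b c] earlier[of c b] total[of b c] by (auto simp: dist_commute)
  qed
  obtain c :: "'a \<Rightarrow> nat" where c_le: "\<forall>a\<in>S. c a \<le> 2 * \<zeta>"
    and c_ne: "\<forall>a\<in>S. \<forall>b\<in>S. (b, a) \<in> R \<longrightarrow> E b a \<longrightarrow> c b \<noteq> c a"
    using wf_greedy_colouring[where S = S and E = E and N = "2 * \<zeta>", OF \<open>wf R\<close>] nb by blast
  \<comment> \<open>The shift by \<open>Suc\<close> turns the colours \<open>0..2 * \<zeta>\<close>
    into the indices \<open>1..2 * \<zeta> + 1\<close>.\<close>
  define G where "G j = {a\<in>S. Suc (c a) = j}" for j
  have disj: "disjoint_family_on (\<lambda>a. cball a (\<rho> a)) (G j)" for j
  proof (unfold disjoint_family_on_def, intro ballI impI)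
    fix a b assume "a \<in> G j" "b \<in> G j" "a \<noteq> b"
    then have "a \<in> S" "b \<in> S" "c a = c b" by (auto simp: G_def)
    then have "\<not> E a b"
      using c_ne total[OF \<open>a \<noteq> b\<close>] by (metis E_def Int_commute)
    then show "cball a (\<rho> a) \<inter> cball b (\<rho> b) = {}" by (simp add: E_def)
  qed
  show ?thesis
  proof (intro exI[of _ G] conjI allI)
    show "G j \<subseteq> A" for j using \<open>S \<subseteq> A\<close> by (auto simp: G_def)
    then show "countable (G j)" for j
      using \<rho> by (intro countable_disjoint_balls[OF sep _ disj]) blast
    show "disjoint_family_on (\<lambda>a. cball a (\<rho> a)) (G j)" for j by (fact disj)
    show "A \<subseteq> (\<Union>j\<in>{1..2 * \<zeta> + 1}. \<Union>a\<in>G j. cball a (\<rho> a))"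
    proof
      fix a assume "a \<in> A"
      have "\<exists>b\<in>S. a \<in> cball b (\<rho> b)"
      proof (cases "a \<in> S")
        case True
        then show ?thesis using \<rho>[OF \<open>a \<in> A\<close>] by force
      next
        case False
        then show ?thesis using S \<open>a \<in> A\<close> by blast
      qed
      then obtain b where "b \<in> S" "a \<in> cball b (\<rho> b)" by blast
      then show "a \<in> (\<Union>j\<in>{1..2 * \<zeta> + 1}. \<Union>a\<in>G j. cball a (\<rho> a))"
        using c_le by (intro UN_I[of "Suc (c b)"] UN_I[of b]) (auto simp: G_def)
    qed
  qed
qed

section \<open>Outer measures\<close>

text \<open>Measurable hulls of equal measure reduce this to subadditivity of
  \<open>emeasure\<close>.\<close>

lemma outer_measure_of_UN_le:
  assumes "finite I" "\<And>i. i \<in> I \<Longrightarrow> T i \<subseteq> space M"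
  shows "outer_measure_of M (\<Union>i\<in>I. T i) \<le> (\<Sum>i\<in>I. outer_measure_of M (T i))"
proof -
  obtain E where E: "\<forall>i\<in>I. E i \<in> sets M \<and> T i \<subseteq> E i \<and> outer_measure_of M (T i) = emeasure M (E i)"
    using outer_measure_of_attain[OF assms(2)] by metis
  have EM: "(\<Union>i\<in>I. E i) \<in> sets M" using E \<open>finite I\<close> by auto
  have "outer_measure_of M (\<Union>i\<in>I. T i) \<le> outer_measure_of M (\<Union>i\<in>I. E i)"
    using E by (intro outer_measure_of_mono) blast
  also have "\<dots> = emeasure M (\<Union>i\<in>I. E i)" using EM by simp
  also have "\<dots> \<le> (\<Sum>i\<in>I. emeasure M (E i))"
    using E \<open>finite I\<close> by (intro emeasure_subadditive_finite) auto
  also have "\<dots> = (\<Sum>i\<in>I. outer_measure_of M (T i))" using E by simp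
  finally show ?thesis .
qed

lemma outer_measure_of_Un_le:
  assumes "S \<subseteq> space M" "T \<subseteq> space M"
  shows "outer_measure_of M (S \<union> T) \<le> outer_measure_of M S + outer_measure_of M T"
proof -
  have "outer_measure_of M (\<Union>b\<in>{True, False}. if b then S else T) \<le>
      (\<Sum>b\<in>{True, False}. outer_measure_of M (if b then S else T))"
    using assms by (intro outer_measure_of_UN_le) auto
  then show ?thesis by (simp add: Un_commute)
qed

lemma outer_measure_of_UN_eq_0:
  fixes T :: "nat \<Rightarrow> 'a set"
  assumes "\<And>n. T n \<subseteq> space M" "\<And>n. outer_measure_of M (T n) = 0"
  shows "outer_measure_of M (\<Union>n. T n) = 0"
proof -
  obtain E where E: "\<And>n. E n \<in> sets M" "\<And>n. T n \<subseteq> E n" "\<And>n. emeasure M (E n) = 0"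
    using outer_measure_of_attain[OF assms(1)] assms(2) by metis
  have "outer_measure_of M (\<Union>n. T n) \<le> outer_measure_of M (\<Union>n. E n)"
    using E by (intro outer_measure_of_mono) blast
  also have "\<dots> = emeasure M (\<Union>n. E n)" using E by (intro outer_measure_of_eq) auto
  also have "\<dots> = 0" using E by (intro emeasure_UN_eq_0) auto
  finally show ?thesis by simp
qed

text \<open>Cutting a measurable hull of \<open>T\<close> by \<open>E\<close> reduces this to
  additivity. It is the half of the Caratheodory condition that subadditivity does not give.\<close>

lemma outer_measure_of_split_ge:
  assumes "T \<subseteq> space M" "E \<in> sets M"
  shows "outer_measure_of M (T \<inter> E) + outer_measure_of M (T - E) \<le> outer_measure_of M T"
proof -
  obtain H where H: "H \<in> sets M" "T \<subseteq> H" "outer_measure_of M T = emeasure M H"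
    using outer_measure_of_attain[OF assms(1)] by blast
  have "outer_measure_of M (T \<inter> E) + outer_measure_of M (T - E)
      \<le> outer_measure_of M (H \<inter> E) + outer_measure_of M (H - E)"
    using H by (intro add_mono outer_measure_of_mono) auto
  also have "\<dots> = emeasure M (H \<inter> E) + emeasure M (H - E)"
    using H assms by simp
  also have "\<dots> = emeasure M (H \<inter> E \<union> (H - E))"
    using H assms by (intro plus_emeasure) auto
  also have "H \<inter> E \<union> (H - E) = H" by blast
  finally show ?thesis using H by simp
qed

section \<open>Points whose small balls all fail to be doubling\<close>

text \<open>For \<open>C = \<gamma> + \<epsilon>\<^sub>0\<close> this is the future exceptional set:
  every other point is the centre of doubling balls of arbitrarily small radius.\<close>

definition nondoubling_points :: "'a::metric_space measure \<Rightarrow> real \<Rightarrow> real \<Rightarrow> 'a set"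
  where "nondoubling_points \<mu> \<alpha> C = {x. \<exists>R>0. \<forall>r. 0 < r \<and> r < R \<longrightarrow>
    \<not> emeasure \<mu> (cball x r) \<le> ennreal C * emeasure \<mu> (cball x (\<alpha> * r))}"

text \<open>A limsup of at most \<gamma> bounds the quotient eventually only by a larger
  \<open>\<gamma>'\<close>. Finiteness and positivity of \<nu> on balls turn the extended quotient
  into an inequality between reals.\<close>

lemma asymptotically_boundedD:
  fixes \<nu> :: "'a::metric_space measure"
  assumes ab: "asymptotically_bounded \<alpha> \<gamma> \<nu>" and "0 < \<alpha>" "0 \<le> \<gamma>" "\<gamma> < \<gamma>'"
  shows "emeasure \<nu> (cball x r) < \<infinity>"
    and "0 < r \<Longrightarrow> 0 < measure \<nu> (cball x r)"
    and "\<exists>R>0. \<forall>r. 0 < r \<and> r < R \<longrightarrow> measure \<nu> (cball x r) \<le> \<gamma>' * measure \<nu> (cball x (\<alpha> * r))"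
proof -
  show fin: "emeasure \<nu> (cball x r) < \<infinity>" for r
    using ab by (auto simp: asymptotically_bounded_def)
  show pos: "0 < measure \<nu> (cball x r)" if "0 < r" for r
  proof -
    have "0 < emeasure \<nu> (cball x r)" using ab that by (auto simp: asymptotically_bounded_def)
    then show ?thesis using fin[of r] by (auto simp: measure_def enn2real_positive_iff)
  qed
  have "Limsup (at_right 0) (\<lambda>r. emeasure \<nu> (cball x r) / emeasure \<nu> (cball x (\<alpha> * r))) < ennreal \<gamma>'"
    using ab \<open>0 \<le> \<gamma>\<close> \<open>\<gamma> < \<gamma>'\<close> unfolding asymptotically_bounded_def
    by (meson ennreal_lessI order_le_less_trans)
  then have "\<forall>\<^sub>F r in at_right 0. emeasure \<nu> (cball x r) / emeasure \<nu> (cball x (\<alpha> * r)) < ennreal \<gamma>'"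
    by (rule Limsup_lessD)
  then obtain R where "R > 0"
    and R: "\<And>r. 0 < r \<Longrightarrow> r < R \<Longrightarrow> emeasure \<nu> (cball x r) / emeasure \<nu> (cball x (\<alpha> * r)) < ennreal \<gamma>'"
    unfolding eventually_at_right_field by auto
  show "\<exists>R>0. \<forall>r. 0 < r \<and> r < R \<longrightarrow> measure \<nu> (cball x r) \<le> \<gamma>' * measure \<nu> (cball x (\<alpha> * r))"
  proof (intro exI[of _ R] conjI allI impI \<open>R > 0\<close>)
    fix r assume r: "0 < r \<and> r < R"
    have eq: "emeasure \<nu> (cball x s) = ennreal (measure \<nu> (cball x s))" for s
      using fin[of s] by (intro emeasure_eq_ennreal_measure) auto
    have p: "0 < measure \<nu> (cball x (\<alpha> * r))" using pos r \<open>0 < \<alpha>\<close> by simp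
    have "ennreal (measure \<nu> (cball x r) / measure \<nu> (cball x (\<alpha> * r))) < ennreal \<gamma>'"
      using R[of r] r p unfolding eq by (simp add: divide_ennreal)
    then have "measure \<nu> (cball x r) / measure \<nu> (cball x (\<alpha> * r)) < \<gamma>'"
      using \<open>0 \<le> \<gamma>\<close> \<open>\<gamma> < \<gamma>'\<close> by (simp add: ennreal_less_iff)
    then show "measure \<nu> (cball x r) \<le> \<gamma>' * measure \<nu> (cball x (\<alpha> * r))"
      using p by (simp add: field_simps)
  qed
qed

text \<open>
  Along the radii \<open>\<alpha> ^ k * s\<close> the measure \<open>\<mu>\<close> decays at least like \<open>C ^ (- k)\<close>, whereas \<open>\<nu>\<close> decays at
  most like \<open>\<gamma>' ^ (- k)\<close> with \<open>\<gamma>' < C\<close>.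
\<close>

lemma nondoubling_point_small_ratio:
  fixes \<mu> \<nu> :: "'a::metric_space measure"
  assumes "0 < \<alpha>" "\<alpha> \<le> 1" "1 \<le> \<gamma>" "\<gamma> < C" and ab: "asymptotically_bounded \<alpha> \<gamma> \<nu>"
    and \<mu>: "borel_measure \<mu>" and x: "x \<in> nondoubling_points \<mu> \<alpha> C"
    and "0 < \<epsilon>" "0 < R"
  shows "\<exists>r. 0 < r \<and> r < R \<and> emeasure \<mu> (cball x r) \<le> ennreal \<epsilon> * emeasure \<nu> (cball x r)"
proof -
  define \<gamma>' where "\<gamma>' = (\<gamma> + C) / 2"
  have \<gamma>': "\<gamma> < \<gamma>'" "\<gamma>' < C" "0 < \<gamma>'" "0 < C" "0 \<le> \<gamma>" using assms by (auto simp: \<gamma>'_def)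
  note abD = asymptotically_boundedD[OF ab \<open>0 < \<alpha>\<close> \<open>0 \<le> \<gamma>\<close> \<open>\<gamma> < \<gamma>'\<close>]
  obtain R1 where "R1 > 0" and R1: "\<And>r. 0 < r \<Longrightarrow> r < R1 \<Longrightarrow>
      ennreal C * emeasure \<mu> (cball x (\<alpha> * r)) < emeasure \<mu> (cball x r)"
    using x unfolding nondoubling_points_def not_le by blast
  obtain R2 where "R2 > 0" and R2: "\<And>r. 0 < r \<Longrightarrow> r < R2 \<Longrightarrow>
      measure \<nu> (cball x r) \<le> \<gamma>' * measure \<nu> (cball x (\<alpha> * r))"
    using abD(3)[of x] by blast
  obtain t where t: "0 < t" "t < R1" "t < R2" "t < R"
    using field_lbound_gt_zero[of R1 "min R2 R"] \<open>R1 > 0\<close> \<open>R2 > 0\<close> \<open>0 < R\<close> by auto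
  \<comment> \<open>The radii start at \<open>\<alpha> * t\<close> because \<mu> may be infinite on
    \<open>cball x t\<close>; the strict inequality at radius \<open>t\<close> forces finiteness one
    step further in.\<close>
  define s where "s k = \<alpha> ^ k * (\<alpha> * t)" for k :: nat
  have s_pos: "0 < s k" for k using t \<open>0 < \<alpha>\<close> by (simp add: s_def)
  have s_le: "s k \<le> t" for k
  proof -
    have "\<alpha> ^ Suc k * t \<le> 1 * t"
      using t assms by (intro mult_right_mono power_le_one) auto
    then show ?thesis by (simp add: s_def algebra_simps)
  qed
  have s_Suc: "s (Suc k) = \<alpha> * s k" for k by (simp add: s_def)
  have fin: "emeasure \<mu> (cball x (s k)) < \<infinity>" for k
  proof -
    have "ennreal C * emeasure \<mu> (cball x (\<alpha> * t)) < \<infinity>"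
      using R1[of t] t by (auto simp: less_top intro: order_less_le_trans)
    then have "emeasure \<mu> (cball x (\<alpha> * t)) < \<infinity>"
      using \<open>0 < C\<close> by (auto simp: ennreal_mult_less_top)
    moreover have "emeasure \<mu> (cball x (s k)) \<le> emeasure \<mu> (cball x (\<alpha> * t))"
    proof (rule emeasure_mono)
      have "s k \<le> \<alpha> * t"
        using t assms by (simp add: s_def mult_left_le_one_le power_le_one)
      then show "cball x (s k) \<subseteq> cball x (\<alpha> * t)" by (rule subset_cball)
      show "cball x (\<alpha> * t) \<in> sets \<mu>" using \<mu> by (simp add: borel_measure_def)
    qed
    ultimately show ?thesis by (rule order_le_less_trans[rotated])
  qed
  define m where "m k = measure \<mu> (cball x (s k))" for k
  define n where "n k = measure \<nu> (cball x (s k))" for k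
  have em: "emeasure \<mu> (cball x (s k)) = ennreal (m k)" for k
    using fin[of k] unfolding m_def by (intro emeasure_eq_ennreal_measure) auto
  have en: "emeasure \<nu> (cball x (s k)) = ennreal (n k)" for k
    using abD(1)[of x "s k"] unfolding n_def by (intro emeasure_eq_ennreal_measure) auto
  have "0 < n 0" unfolding n_def by (rule abD(2)[OF s_pos])
  have "0 \<le> m k" for k by (simp add: m_def)
  have m_Suc: "C * m (Suc k) \<le> m k" for k
  proof -
    have "ennreal (C * m (Suc k)) < ennreal (m k)"
      using R1[of "s k"] s_pos[of k] s_le[of k] t \<open>0 < C\<close> em[of k] em[of "Suc k"]
      by (simp add: s_Suc ennreal_mult' )
    then show ?thesis using \<open>0 < C\<close> \<open>0 \<le> m (Suc k)\<close> by (simp add: ennreal_less_iff)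
  qed
  have n_Suc: "n k \<le> \<gamma>' * n (Suc k)" for k
    using R2[of "s k"] s_pos[of k] s_le[of k] t by (simp add: n_def s_Suc)
  have m_le: "C ^ k * m k \<le> m 0" for k
  proof (induction k)
    case (Suc k)
    have "C ^ k * (C * m (Suc k)) \<le> C ^ k * m k"
      using m_Suc \<open>0 < C\<close> by (intro mult_left_mono) auto
    with Suc show ?case by (simp add: algebra_simps)
  qed simp
  have n_le: "n 0 \<le> \<gamma>' ^ k * n k" for k
  proof (induction k)
    case (Suc k)
    have "\<gamma>' ^ k * n k \<le> \<gamma>' ^ k * (\<gamma>' * n (Suc k))"
      using n_Suc \<open>0 < \<gamma>'\<close> by (intro mult_left_mono) auto
    with Suc show ?case by (simp add: algebra_simps)
  qed simp
  \<comment> \<open>The decay estimates give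
    \<open>m k / n k \<le> (\<gamma>' / C) ^ k * m 0 / n 0\<close>. The summand 1 keeps the
    denominator positive, as only \<open>0 \<le> m 0\<close> is at hand.\<close>
  obtain k where k: "(\<gamma>' / C) ^ k < \<epsilon> * n 0 / (m 0 + 1)"
    using real_arch_pow_inv[of "\<epsilon> * n 0 / (m 0 + 1)" "\<gamma>' / C"] \<open>0 < n 0\<close> \<open>0 \<le> m 0\<close> \<open>0 < \<epsilon>\<close> \<gamma>' by auto
  have "m k \<le> \<epsilon> * n k"
  proof -
    have "\<gamma>' ^ k * (m 0 + 1) < C ^ k * (\<epsilon> * n 0)"
      using k \<gamma>' \<open>0 \<le> m 0\<close> by (simp add: power_divide field_simps)
    moreover have "0 < \<gamma>' ^ k" using \<gamma>' by simp
    ultimately have "\<gamma>' ^ k * m 0 \<le> C ^ k * (\<epsilon> * n 0)" by (simp add: algebra_simps)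
    moreover have "\<gamma>' ^ k * (C ^ k * m k) \<le> \<gamma>' ^ k * m 0"
      using m_le \<gamma>' by (intro mult_left_mono) auto
    moreover have "C ^ k * (\<epsilon> * n 0) \<le> C ^ k * (\<epsilon> * (\<gamma>' ^ k * n k))"
      using n_le \<gamma>' \<open>0 < \<epsilon>\<close> by (intro mult_left_mono) auto
    ultimately have "(\<gamma>' ^ k * C ^ k) * m k \<le> (\<gamma>' ^ k * C ^ k) * (\<epsilon> * n k)"
      by (simp add: algebra_simps)
    then show ?thesis using \<gamma>' by simp
  qed
  then have "emeasure \<mu> (cball x (s k)) \<le> ennreal \<epsilon> * emeasure \<nu> (cball x (s k))"
    using \<open>0 < \<epsilon>\<close> unfolding em en by (simp add: ennreal_mult'[symmetric] ennreal_leI)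
  then show ?thesis
    using s_pos[of k] s_le[of k] t by (intro exI[of _ "s k"]) auto
qed

lemma emeasure_disjoint_UN_le:
  assumes "countable G" "disjoint_family_on B G"
    and \<mu>: "\<And>a. a \<in> G \<Longrightarrow> B a \<in> sets \<mu>" and \<nu>: "\<And>a. a \<in> G \<Longrightarrow> B a \<in> sets \<nu>"
    and "\<And>a. a \<in> G \<Longrightarrow> emeasure \<mu> (B a) \<le> c * emeasure \<nu> (B a)"
  shows "emeasure \<mu> (\<Union>a\<in>G. B a) \<le> c * emeasure \<nu> (\<Union>a\<in>G. B a)"
proof -
  have "emeasure \<mu> (\<Union>a\<in>G. B a) = (\<integral>\<^sup>+a. emeasure \<mu> (B a) \<partial>count_space G)"
    using assms by (intro emeasure_UN_countable) auto
  also have "\<dots> \<le> (\<integral>\<^sup>+a. c * emeasure \<nu> (B a) \<partial>count_space G)"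
    using assms by (intro nn_integral_mono) auto
  also have "\<dots> = c * (\<integral>\<^sup>+a. emeasure \<nu> (B a) \<partial>count_space G)"
    by (intro nn_integral_cmult) auto
  also have "\<dots> = c * emeasure \<nu> (\<Union>a\<in>G. B a)"
    using assms by (subst emeasure_UN_countable) auto
  finally show ?thesis .
qed

text \<open>On a bounded piece, \<open>2 * \<zeta> + 1\<close> disjoint families of balls with \<mu>
  at most \<epsilon> times \<nu> bound the outer measure by \<epsilon> times a finite constant.
  Radii below 1 keep these balls in a bounded set, where \<nu> is finite.\<close>

lemma nondoubling_points_null:
  fixes \<mu> \<nu> :: "'a::metric_space measure"
  assumes sep: "separable_space (euclidean :: 'a topology)"
    and dl: "directionally_limited_at \<xi> \<eta> \<zeta> (UNIV :: 'a set)" and "\<eta> \<le> 1 / 3" and "0 < \<xi>"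
    and "0 < \<alpha>" "\<alpha> \<le> 1" "1 \<le> \<gamma>" "\<gamma> < C" and ab: "asymptotically_bounded \<alpha> \<gamma> \<nu>"
    and \<mu>_borel: "borel_measure \<mu>"
  shows "outer_measure_of \<mu> (nondoubling_points \<mu> \<alpha> C) = 0"
proof -
  have \<nu>: "sets \<nu> = sets borel" and \<nu>_fin: "\<And>S. S \<in> sets borel \<Longrightarrow> bounded S \<Longrightarrow> emeasure \<nu> S < \<infinity>"
    using ab by (auto simp: asymptotically_bounded_def borel_measure_def)
  have \<mu>: "sets \<mu> = sets borel" and space: "space \<mu> = UNIV"
    using \<mu>_borel by (auto simp: borel_measure_def dest: sets_eq_imp_space_eq)
  obtain x0 :: 'a where True by blast
  define N where "N n = nondoubling_points \<mu> \<alpha> C \<inter> ball x0 (real n)" for n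
  have bound: "outer_measure_of \<mu> (N n) \<le>
      ennreal \<epsilon> * (of_nat (2 * \<zeta> + 1) * emeasure \<nu> (ball x0 (real n + 1)))" if "0 < \<epsilon>" for n \<epsilon>
  proof -
    have "\<forall>x\<in>N n. \<exists>r. 0 < r \<and> r < min (\<xi> / 2) 1 \<and> emeasure \<mu> (cball x r) \<le> ennreal \<epsilon> * emeasure \<nu> (cball x r)"
      using assms that
      by (intro ballI nondoubling_point_small_ratio[OF \<open>0 < \<alpha>\<close> \<open>\<alpha> \<le> 1\<close> \<open>1 \<le> \<gamma>\<close> \<open>\<gamma> < C\<close> ab \<mu>_borel])
        (auto simp: N_def)
    then obtain \<rho> where \<rho>: "\<And>x. x \<in> N n \<Longrightarrow> 0 < \<rho> x \<and> \<rho> x < min (\<xi> / 2) 1 \<and>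
        emeasure \<mu> (cball x (\<rho> x)) \<le> ennreal \<epsilon> * emeasure \<nu> (cball x (\<rho> x))"
      by metis
    then have "0 < \<rho> x \<and> \<rho> x < \<xi> / 2" if "x \<in> N n" for x using that by auto
    then obtain G where G': "\<forall>j. G j \<subseteq> N n \<and> countable (G j) \<and>
        disjoint_family_on (\<lambda>a. cball a (\<rho> a)) (G j)"
      and cover: "N n \<subseteq> (\<Union>j\<in>{1..2 * \<zeta> + 1}. \<Union>a\<in>G j. cball a (\<rho> a))"
      using besicovitch_covering[OF sep dl \<open>\<eta> \<le> 1 / 3\<close>, of "N n" \<rho>] by blast
    then have G: "G j \<subseteq> N n" "countable (G j)" "disjoint_family_on (\<lambda>a. cball a (\<rho> a)) (G j)" for j
      by blast+
    define U where "U j = (\<Union>a\<in>G j. cball a (\<rho> a))" for j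
    have U: "U j \<in> sets borel" for j
      unfolding U_def using G(2) by (intro sets.countable_UN') auto
    have U_le: "emeasure \<mu> (U j) \<le> ennreal \<epsilon> * emeasure \<nu> (ball x0 (real n + 1))" for j
    proof -
      have "emeasure \<mu> (U j) \<le> ennreal \<epsilon> * emeasure \<nu> (U j)"
        unfolding U_def
      proof (rule emeasure_disjoint_UN_le[OF G(2,3)])
        fix a assume "a \<in> G j"
        then show "emeasure \<mu> (cball a (\<rho> a)) \<le> ennreal \<epsilon> * emeasure \<nu> (cball a (\<rho> a))"
          using \<rho> G(1) by blast
      qed (simp_all add: \<mu> \<nu>)
      also have "U j \<subseteq> ball x0 (real n + 1)"
      proof
        fix y assume "y \<in> U j"
        then obtain a where a: "a \<in> N n" "dist a y \<le> \<rho> a" using G(1) by (auto simp: U_def)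
        then have "dist x0 a < real n" "\<rho> a < 1" using \<rho> by (auto simp: N_def)
        then show "y \<in> ball x0 (real n + 1)" using a dist_triangle[of x0 y a] by simp
      qed
      then have "ennreal \<epsilon> * emeasure \<nu> (U j) \<le> ennreal \<epsilon> * emeasure \<nu> (ball x0 (real n + 1))"
        by (intro mult_left_mono emeasure_mono) (auto simp: \<nu>)
      finally show ?thesis .
    qed
    have "outer_measure_of \<mu> (N n) \<le> outer_measure_of \<mu> (\<Union>j\<in>{1..2 * \<zeta> + 1}. U j)"
      using cover by (intro outer_measure_of_mono) (simp add: U_def)
    also have "\<dots> \<le> (\<Sum>j\<in>{1..2 * \<zeta> + 1}. outer_measure_of \<mu> (U j))"
      by (intro outer_measure_of_UN_le) (auto simp: space)
    also have "\<dots> = (\<Sum>j\<in>{1..2 * \<zeta> + 1}. emeasure \<mu> (U j))"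
      using U by (intro sum.cong) (auto simp: \<mu>)
    also have "\<dots> \<le> (\<Sum>j\<in>{1..2 * \<zeta> + 1}. ennreal \<epsilon> * emeasure \<nu> (ball x0 (real n + 1)))"
      by (intro sum_mono U_le)
    also have "\<dots> = ennreal \<epsilon> * (of_nat (2 * \<zeta> + 1) * emeasure \<nu> (ball x0 (real n + 1)))"
      by (simp only: sum_constant card_atLeastAtMost diff_Suc_1 ac_simps)
    finally show ?thesis .
  qed
  have "outer_measure_of \<mu> (N n) = 0" for n
  proof -
    define W where "W = real (2 * \<zeta> + 1) * measure \<nu> (ball x0 (real n + 1))"
    have "0 \<le> W" by (simp add: W_def)
    have W: "of_nat (2 * \<zeta> + 1) * emeasure \<nu> (ball x0 (real n + 1)) = ennreal W"
    proof -
      have "emeasure \<nu> (ball x0 (real n + 1)) = ennreal (measure \<nu> (ball x0 (real n + 1)))"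
        using \<nu>_fin[of "ball x0 (real n + 1)"] by (intro emeasure_eq_ennreal_measure) auto
      then show ?thesis
        unfolding W_def by (simp only: ennreal_mult' of_nat_0_le_iff ennreal_of_nat_eq_real_of_nat)
    qed
    have "outer_measure_of \<mu> (N n) \<le> 0"
    proof (rule ennreal_le_epsilon)
      fix e :: real assume "0 < e"
      have "outer_measure_of \<mu> (N n) \<le> ennreal (e / (W + 1)) * ennreal W"
        using bound[of "e / (W + 1)" n] \<open>0 < e\<close> \<open>0 \<le> W\<close> unfolding W by simp
      also have "\<dots> = ennreal (e / (W + 1) * W)" using \<open>0 < e\<close> \<open>0 \<le> W\<close> by (intro ennreal_mult'[symmetric]) simp
      also have "\<dots> \<le> ennreal e"
        using \<open>0 < e\<close> \<open>0 \<le> W\<close> by (intro ennreal_leI) (simp add: field_simps)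
      finally show "outer_measure_of \<mu> (N n) \<le> 0 + ennreal e" by simp
    qed
    then show ?thesis by simp
  qed
  then have "outer_measure_of \<mu> (\<Union>n. N n) = 0"
    by (intro outer_measure_of_UN_eq_0) (auto simp: space)
  moreover have "(\<Union>n. N n) = nondoubling_points \<mu> \<alpha> C"
    using reals_Archimedean2 by (auto simp: N_def)
  ultimately show ?thesis by simp
qed

section \<open>Almost covering by disjoint balls of a fine family\<close>

text \<open>These are the fine covers in the sense of Vitali; smallness refers to the radius stored
  in the pair, not to the diameter of the point set.\<close>

definition fine_at :: "('a::metric_space \<times> real) set \<Rightarrow> 'a set \<Rightarrow> bool"
  where "fine_at F T \<longleftrightarrow> (\<forall>a\<in>T. \<forall>e>0. \<exists>r. 0 < r \<and> r < e \<and> (a, r) \<in> F)"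

text \<open>Fineness lets every point choose a ball of \<open>F\<close> inside \<open>V\<close> with
  radius below \<xi>/2, and the covering theorem applies to these. Staying inside \<open>V\<close>
  later serves to avoid balls already chosen.\<close>

lemma fine_cover:
  fixes F :: "('a::metric_space \<times> real) set"
  assumes sep: "separable_space (euclidean :: 'a topology)"
    and dl: "directionally_limited_at \<xi> \<eta> \<zeta> (UNIV :: 'a set)" and "\<eta> \<le> 1 / 3" and "0 < \<xi>"
    and fine: "fine_at F T" and "open V" "T \<subseteq> V"
  shows "\<exists>\<G> :: nat \<Rightarrow> ('a \<times> real) set.
    (\<forall>j. \<G> j \<subseteq> F \<and> countable (\<G> j) \<and> disjoint_family_on closed_ball (\<G> j) \<and>
      (\<Union>B\<in>\<G> j. closed_ball B) \<subseteq> V) \<and>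
    T \<subseteq> (\<Union>j\<in>{1..2 * \<zeta> + 1}. \<Union>B\<in>\<G> j. closed_ball B)"
proof -
  have "\<exists>r. 0 < r \<and> r < \<xi> / 2 \<and> cball a r \<subseteq> V \<and> (a, r) \<in> F" if "a \<in> T" for a
  proof -
    obtain e where "0 < e" "cball a e \<subseteq> V"
      using \<open>open V\<close>[unfolded open_contains_cball, rule_format, of a] \<open>T \<subseteq> V\<close> \<open>a \<in> T\<close> by blast
    moreover obtain r where "0 < r" "r < min e (\<xi> / 2)" "(a, r) \<in> F"
    proof -
      have "0 < min e (\<xi> / 2)" using \<open>0 < e\<close> \<open>0 < \<xi>\<close> by simp
      then show ?thesis using fine \<open>a \<in> T\<close> that unfolding fine_at_def by blast
    qed
    moreover have "cball a r \<subseteq> cball a e" using \<open>r < min e (\<xi> / 2)\<close> by (intro subset_cball) simp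
    ultimately show ?thesis by (intro exI[of _ r]) auto
  qed
  then obtain \<rho> where \<rho>: "\<forall>a\<in>T. 0 < \<rho> a \<and> \<rho> a < \<xi> / 2 \<and> cball a (\<rho> a) \<subseteq> V \<and> (a, \<rho> a) \<in> F"
    by metis
  then have "0 < \<rho> a \<and> \<rho> a < \<xi> / 2" if "a \<in> T" for a using that by blast
  then obtain G where G: "\<forall>j. G j \<subseteq> T \<and> countable (G j) \<and> disjoint_family_on (\<lambda>a. cball a (\<rho> a)) (G j)"
    and cover: "T \<subseteq> (\<Union>j\<in>{1..2 * \<zeta> + 1}. \<Union>a\<in>G j. cball a (\<rho> a))"
    using besicovitch_covering[OF sep dl \<open>\<eta> \<le> 1 / 3\<close>, of T \<rho>] by blast
  define \<G> where "\<G> j = (\<lambda>a. (a, \<rho> a)) ` G j" for j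
  show ?thesis
  proof (intro exI[of _ \<G>] conjI allI)
    fix j
    have Gj: "G j \<subseteq> T" "countable (G j)" "disjoint_family_on (\<lambda>a. cball a (\<rho> a)) (G j)"
      using G by blast+
    show "\<G> j \<subseteq> F" "(\<Union>B\<in>\<G> j. closed_ball B) \<subseteq> V"
      using \<rho> Gj(1) by (auto simp: \<G>_def)
    show "countable (\<G> j)" using Gj(2) by (simp add: \<G>_def)
    show "disjoint_family_on closed_ball (\<G> j)"
      using Gj(3) by (auto simp: \<G>_def disjoint_family_on_def)
  qed (use cover in \<open>simp add: \<G>_def\<close>)
qed

text \<open>Outer measure is continuous along increasing unions even of non-measurable sets, so
  finite parts of an enumeration suffice.\<close>

lemma outer_measure_of_finite_subfamily:
  assumes "countable \<G>" "\<And>B. B \<in> \<G> \<Longrightarrow> D B \<subseteq> space M"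
    and c: "c < outer_measure_of M (T \<inter> (\<Union>B\<in>\<G>. D B))"
  shows "\<exists>H\<subseteq>\<G>. finite H \<and> c < outer_measure_of M (T \<inter> (\<Union>B\<in>H. D B))"
proof (cases "\<G> = {}")
  case True
  then show ?thesis using c by auto
next
  case False
  define H where "H n = from_nat_into \<G> ` {..<n}" for n :: nat
  have H: "H n \<subseteq> \<G>" "finite (H n)" for n
    using from_nat_into[OF False] by (auto simp: H_def)
  have UN: "(\<Union>n. T \<inter> (\<Union>B\<in>H n. D B)) = T \<inter> (\<Union>B\<in>\<G>. D B)"
  proof -
    have "(\<Union>n. H n) = \<G>"
      using range_from_nat_into[OF False \<open>countable \<G>\<close>] by (auto simp: H_def)
    then show ?thesis by blast
  qed
  have "(SUP n. outer_measure_of M (T \<inter> (\<Union>B\<in>H n. D B))) = outer_measure_of M (\<Union>n. T \<inter> (\<Union>B\<in>H n. D B))"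
  proof (rule SUP_outer_measure_of_incseq)
    show "T \<inter> (\<Union>B\<in>H n. D B) \<subseteq> space M" for n
      using H(1)[of n] assms(2) by blast
    show "incseq (\<lambda>n. T \<inter> (\<Union>B\<in>H n. D B))"
      by (intro monoI) (force simp: H_def)
  qed
  with c have "c < (SUP n. outer_measure_of M (T \<inter> (\<Union>B\<in>H n. D B)))"
    unfolding UN by simp
  then obtain n where "c < outer_measure_of M (T \<inter> (\<Union>B\<in>H n. D B))"
    unfolding less_SUP_iff by blast
  with H[of n] show ?thesis by blast
qed

text \<open>One colour captures its share of \<open>T\<close>, and already a finite part of it
  captures enough. The factor left over depends only on \<zeta>, so the step can be
  iterated.\<close>

lemma finite_partial_cover:
  fixes F :: "('a::metric_space \<times> real) set"
  assumes sep: "separable_space (euclidean :: 'a topology)"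
    and dl: "directionally_limited_at \<xi> \<eta> \<zeta> (UNIV :: 'a set)" and "\<eta> \<le> 1 / 3" and "0 < \<xi>"
    and \<mu>: "borel_measure \<mu>"
    and fine: "fine_at F T" and "open V" "T \<subseteq> V" and fin: "outer_measure_of \<mu> T < \<infinity>"
  shows "\<exists>H\<subseteq>F. finite H \<and> disjoint_family_on closed_ball H \<and> (\<Union>B\<in>H. closed_ball B) \<subseteq> V \<and>
    outer_measure_of \<mu> (T - (\<Union>B\<in>H. closed_ball B)) \<le>
      ennreal ((2 * real \<zeta> + 1) / (2 * real \<zeta> + 2)) * outer_measure_of \<mu> T"
proof (cases "outer_measure_of \<mu> T = 0")
  case True
  then show ?thesis by (intro exI[of _ "{}"]) (auto simp: disjoint_family_on_def)
next
  case False
  have \<mu>_sets: "sets \<mu> = sets borel" and space: "space \<mu> = UNIV"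
    using \<mu> by (auto simp: borel_measure_def dest: sets_eq_imp_space_eq)
  define m where "m = enn2real (outer_measure_of \<mu> T)"
  have m: "outer_measure_of \<mu> T = ennreal m" "0 < m"
    using fin False by (auto simp: m_def enn2real_positive_iff less_top zero_less_iff_neq_zero)
  obtain \<G> where G': "\<forall>j. \<G> j \<subseteq> F \<and> countable (\<G> j) \<and> disjoint_family_on closed_ball (\<G> j) \<and>
      (\<Union>B\<in>\<G> j. closed_ball B) \<subseteq> V"
    and cover: "T \<subseteq> (\<Union>j\<in>{1..2 * \<zeta> + 1}. \<Union>B\<in>\<G> j. closed_ball B)"
    using fine_cover[OF sep dl \<open>\<eta> \<le> 1 / 3\<close> \<open>0 < \<xi>\<close> fine \<open>open V\<close> \<open>T \<subseteq> V\<close>] by blast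
  then have G: "\<G> j \<subseteq> F" "countable (\<G> j)" "disjoint_family_on closed_ball (\<G> j)"
    "(\<Union>B\<in>\<G> j. closed_ball B) \<subseteq> V" for j
    by blast+
  \<comment> \<open>The denominator exceeds the number of colours by one, so
    \<open>(2 * real \<zeta> + 1) * p < m\<close> and some colour captures strictly more than
    \<open>p\<close>; strictness allows the passage to finitely many balls.\<close>
  define p where "p = m / (2 * real \<zeta> + 2)"
  have "0 < p" using m by (simp add: p_def)
  have "\<exists>j. ennreal p < outer_measure_of \<mu> (T \<inter> (\<Union>B\<in>\<G> j. closed_ball B))"
  proof (rule ccontr)
    assume *: "\<not> ?thesis"
    have "outer_measure_of \<mu> T \<le> outer_measure_of \<mu> (\<Union>j\<in>{1..2 * \<zeta> + 1}. T \<inter> (\<Union>B\<in>\<G> j. closed_ball B))"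
      using cover by (intro outer_measure_of_mono) blast
    also have "\<dots> \<le> (\<Sum>j\<in>{1..2 * \<zeta> + 1}. outer_measure_of \<mu> (T \<inter> (\<Union>B\<in>\<G> j. closed_ball B)))"
      by (intro outer_measure_of_UN_le) (auto simp: space)
    also have "\<dots> \<le> (\<Sum>j\<in>{1..2 * \<zeta> + 1}. ennreal p)"
      using * by (intro sum_mono) (simp add: not_less)
    also have "\<dots> = ennreal (\<Sum>j\<in>{1..2 * \<zeta> + 1}. p)"
      using \<open>0 < p\<close> by (intro sum_ennreal) simp
    also have "(\<Sum>j\<in>{1..2 * \<zeta> + 1}. p) = (2 * real \<zeta> + 1) * p"
      by simp
    finally have "ennreal m \<le> ennreal ((2 * real \<zeta> + 1) * p)"
      unfolding m(1) .
    then have "m \<le> (2 * real \<zeta> + 1) * p"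
      using \<open>0 < p\<close> by (subst (asm) ennreal_le_iff) auto
    with \<open>0 < m\<close> show False by (simp add: p_def field_simps)
  qed
  then obtain j where j: "ennreal p < outer_measure_of \<mu> (T \<inter> (\<Union>B\<in>\<G> j. closed_ball B))" by blast
  obtain H where H: "H \<subseteq> \<G> j" "finite H" "ennreal p < outer_measure_of \<mu> (T \<inter> (\<Union>B\<in>H. closed_ball B))"
    using outer_measure_of_finite_subfamily[OF G(2)[of j] _ j] by (auto simp: space)
  have "ennreal p + outer_measure_of \<mu> (T - (\<Union>B\<in>H. closed_ball B)) \<le>
      outer_measure_of \<mu> (T \<inter> (\<Union>B\<in>H. closed_ball B)) + outer_measure_of \<mu> (T - (\<Union>B\<in>H. closed_ball B))"
    using H(3) by (intro add_right_mono) simp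
  also have "\<dots> \<le> ennreal m"
    unfolding m(1)[symmetric]
  proof (rule outer_measure_of_split_ge)
    show "(\<Union>B\<in>H. closed_ball B) \<in> sets \<mu>"
      unfolding \<mu>_sets using \<open>finite H\<close> by (intro sets.finite_UN) auto
  qed (simp add: space)
  finally have "outer_measure_of \<mu> (T - (\<Union>B\<in>H. closed_ball B)) \<le> ennreal m - ennreal p"
    by (simp add: ennreal_le_minus_iff add.commute)
  also have "\<dots> = ennreal (m - p)"
    using \<open>0 < p\<close> by (intro ennreal_minus) simp
  also have "m - p = (2 * real \<zeta> + 1) / (2 * real \<zeta> + 2) * m"
    by (simp add: p_def field_simps)
  also have "ennreal ((2 * real \<zeta> + 1) / (2 * real \<zeta> + 2) * m) =
      ennreal ((2 * real \<zeta> + 1) / (2 * real \<zeta> + 2)) * outer_measure_of \<mu> T"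
    unfolding m(1) by (rule ennreal_mult') simp
  finally show ?thesis
    using H G[of j] by (intro exI[of _ H] conjI) (blast intro: disjoint_family_on_mono)+
qed

text \<open>Removing finitely many closed balls leaves an open set in which the next round can work.
  The uncovered outer measure shrinks by the factor \<open>q\<close> in each round.\<close>

theorem vitali_covering_fine_family:
  fixes F :: "('a::metric_space \<times> real) set"
  assumes sep: "separable_space (euclidean :: 'a topology)"
    and dl: "directionally_limited_at \<xi> \<eta> \<zeta> (UNIV :: 'a set)" and "\<eta> \<le> 1 / 3" and "0 < \<xi>"
    and \<mu>: "borel_measure \<mu>"
    and fine: "fine_at F T" and "open U" "T \<subseteq> U" and fin: "outer_measure_of \<mu> T < \<infinity>"
  shows "\<exists>\<G>\<subseteq>F. countable \<G> \<and> disjoint_family_on closed_ball \<G> \<and> (\<Union>B\<in>\<G>. closed_ball B) \<subseteq> U \<and>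
    outer_measure_of \<mu> (T - (\<Union>B\<in>\<G>. closed_ball B)) = 0"
proof -
  define q where "q = (2 * real \<zeta> + 1) / (2 * real \<zeta> + 2)"
  have q: "0 \<le> q" "q < 1" by (auto simp: q_def)
  have "\<exists>H\<subseteq>F. finite H \<and> disjoint_family_on closed_ball H \<and> (\<Union>B\<in>H. closed_ball B) \<subseteq> V \<and>
      outer_measure_of \<mu> (T \<inter> V - (\<Union>B\<in>H. closed_ball B)) \<le> ennreal q * outer_measure_of \<mu> (T \<inter> V)"
    if "open V" for V
  proof -
    have "fine_at F (T \<inter> V)" using fine by (simp add: fine_at_def)
    moreover have "outer_measure_of \<mu> (T \<inter> V) < \<infinity>"
      using fin by (rule order_le_less_trans[OF outer_measure_of_mono, rotated]) simp
    ultimately show ?thesis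
      using finite_partial_cover[OF sep dl \<open>\<eta> \<le> 1 / 3\<close> \<open>0 < \<xi>\<close> \<mu> _ that, of F "T \<inter> V"] by (simp add: q_def)
  qed
  \<comment> \<open>Choosing a family for every open \<open>V\<close> at once makes the rounds a
    plain recursion.\<close>
  then obtain h where h: "\<forall>V. open V \<longrightarrow> h V \<subseteq> F \<and> finite (h V) \<and> disjoint_family_on closed_ball (h V) \<and>
      (\<Union>B\<in>h V. closed_ball B) \<subseteq> V \<and>
      outer_measure_of \<mu> (T \<inter> V - (\<Union>B\<in>h V. closed_ball B)) \<le> ennreal q * outer_measure_of \<mu> (T \<inter> V)"
    by metis
  define V where "V = rec_nat U (\<lambda>_ V. V - (\<Union>B\<in>h V. closed_ball B))"
  have V_0: "V 0 = U" and V_Suc: "V (Suc n) = V n - (\<Union>B\<in>h (V n). closed_ball B)" for n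
    by (simp_all add: V_def)
  have "open (V n)" for n
  proof (induction n)
    case (Suc n)
    then have "closed (\<Union>B\<in>h (V n). closed_ball B)"
      using h by (intro closed_UN) auto
    with Suc show ?case by (simp add: V_Suc open_Diff)
  qed (simp add: V_0 \<open>open U\<close>)
  then have hV: "h (V n) \<subseteq> F" "finite (h (V n))" "disjoint_family_on closed_ball (h (V n))"
    "(\<Union>B\<in>h (V n). closed_ball B) \<subseteq> V n"
    "outer_measure_of \<mu> (T \<inter> V n - (\<Union>B\<in>h (V n). closed_ball B)) \<le> ennreal q * outer_measure_of \<mu> (T \<inter> V n)" for n
    using h by blast+
  have "decseq V" by (rule decseq_SucI) (auto simp: V_Suc)
  define \<G> where "\<G> = (\<Union>n. h (V n))"
  \<comment> \<open>Balls of round \<open>j\<close> lie in \<open>V j\<close>, from which those of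
    the earlier round \<open>i\<close> have been removed.\<close>
  have disj: "closed_ball B \<inter> closed_ball B' = {}" if "B \<in> h (V i)" "B' \<in> h (V j)" "i < j" for B B' i j
  proof -
    have "closed_ball B' \<subseteq> V j" using hV(4)[of j] that by blast
    also have "\<dots> \<subseteq> V (Suc i)" using \<open>decseq V\<close> that by (simp add: decseq_def)
    finally show ?thesis using that(1) unfolding V_Suc by blast
  qed
  have "outer_measure_of \<mu> (T \<inter> V n) \<le> ennreal (q ^ n) * outer_measure_of \<mu> T" for n
  proof (induction n)
    case 0
    show ?case by (simp add: outer_measure_of_mono)
  next
    case (Suc n)
    have "T \<inter> V (Suc n) = T \<inter> V n - (\<Union>B\<in>h (V n). closed_ball B)" by (auto simp: V_Suc)
    then have "outer_measure_of \<mu> (T \<inter> V (Suc n)) \<le> ennreal q * outer_measure_of \<mu> (T \<inter> V n)"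
      using hV(5)[of n] by simp
    also have "\<dots> \<le> ennreal q * (ennreal (q ^ n) * outer_measure_of \<mu> T)"
      by (intro mult_left_mono Suc.IH) simp
    also have "\<dots> = ennreal (q ^ Suc n) * outer_measure_of \<mu> T"
      using q by (simp add: ennreal_mult' mult.assoc)
    finally show ?case .
  qed
  moreover have "outer_measure_of \<mu> (T - (\<Union>B\<in>\<G>. closed_ball B)) \<le> outer_measure_of \<mu> (T \<inter> V n)" for n
  proof (rule outer_measure_of_mono)
    have "T - (\<Union>B\<in>\<G>. closed_ball B) \<subseteq> V n"
    proof (induction n)
      case 0
      show ?case using \<open>T \<subseteq> U\<close> by (auto simp: V_0)
    next
      case (Suc n)
      have "(\<Union>B\<in>h (V n). closed_ball B) \<subseteq> (\<Union>B\<in>\<G>. closed_ball B)" by (auto simp: \<G>_def)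
      with Suc show ?case unfolding V_Suc by blast
    qed
    then show "T - (\<Union>B\<in>\<G>. closed_ball B) \<subseteq> T \<inter> V n" by blast
  qed
  ultimately have le: "outer_measure_of \<mu> (T - (\<Union>B\<in>\<G>. closed_ball B)) \<le> ennreal (q ^ n) * outer_measure_of \<mu> T" for n
    by (rule order_trans[rotated])
  \<comment> \<open>Finiteness of the outer measure of \<open>T\<close> matters here: multiplication
    of extended reals is not continuous at \<open>0 * \<infinity>\<close>.\<close>
  have "(\<lambda>n. ennreal (q ^ n) * outer_measure_of \<mu> T) \<longlonglongrightarrow> ennreal 0 * outer_measure_of \<mu> T"
    using q fin by (intro tendsto_mult_ennreal tendsto_ennrealI LIMSEQ_power_zero tendsto_const) auto
  then have "outer_measure_of \<mu> (T - (\<Union>B\<in>\<G>. closed_ball B)) \<le> ennreal 0 * outer_measure_of \<mu> T"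
    by (rule LIMSEQ_le_const) (use le in blast)
  then have "outer_measure_of \<mu> (T - (\<Union>B\<in>\<G>. closed_ball B)) = 0" by simp
  moreover have "disjoint_family_on closed_ball \<G>"
    unfolding disjoint_family_on_def
  proof (intro ballI impI)
    fix B B' assume "B \<in> \<G>" "B' \<in> \<G>" "B \<noteq> B'"
    then obtain i j where "B \<in> h (V i)" "B' \<in> h (V j)" by (auto simp: \<G>_def)
    then show "closed_ball B \<inter> closed_ball B' = {}"
      using disj[of B i B' j] disj[of B' j B i] hV(3)[of i] \<open>B \<noteq> B'\<close>
      by (cases i j rule: linorder_cases) (auto simp: disjoint_family_on_def)
  qed
  moreover have "\<G> \<subseteq> F" using hV(1) by (auto simp: \<G>_def)
  moreover have "countable \<G>" unfolding \<G>_def using hV(2) countable_finite by (intro countable_UN) auto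
  moreover have "(\<Union>B\<in>\<G>. closed_ball B) \<subseteq> U"
  proof -
    have "(\<Union>B\<in>h (V n). closed_ball B) \<subseteq> U" for n
      using hV(4)[of n] \<open>decseq V\<close> V_0 by (metis decseq_def le0 order_trans)
    then show ?thesis unfolding \<G>_def by blast
  qed
  ultimately show ?thesis by blast
qed

section \<open>Doubling balls as a fine family, and the two claims\<close>

lemma diameter_cball_le:
  fixes x :: "'a::metric_space"
  assumes "0 \<le> r"
  shows "diameter (cball x r) \<le> 2 * r"
proof -
  have "(SUP (y, z)\<in>cball x r \<times> cball x r. dist y z) \<le> 2 * r"
  proof (rule cSUP_least)
    show "cball x r \<times> cball x r \<noteq> {}" using assms by auto
    fix p assume "p \<in> cball x r \<times> cball x r"
    then obtain y z where "p = (y, z)" "dist x y \<le> r" "dist x z \<le> r" by auto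
    then show "(case p of (y, z) \<Rightarrow> dist y z) \<le> 2 * r"
      using dist_triangle3[of y z x] by simp
  qed
  then show ?thesis using assms by (simp add: diameter_def)
qed

text \<open>Off the nondoubling points there are doubling radii below every bound; those below
  \<delta> also satisfy the diameter condition.\<close>

lemma fine_at_centered_ball_family:
  assumes "0 < \<delta>" "0 < \<alpha>"
  shows "fine_at (\<F>\<^sub>A \<mu> \<alpha> C \<delta> A) (A - nondoubling_points \<mu> \<alpha> C)"
  unfolding fine_at_def
proof (intro ballI allI impI)
  fix a and e :: real assume a: "a \<in> A - nondoubling_points \<mu> \<alpha> C" and "0 < e"
  then have "0 < min e \<delta>" using \<open>0 < \<delta>\<close> by simp
  then obtain r where r: "0 < r" "r < min e \<delta>"
    "emeasure \<mu> (cball a r) \<le> ennreal C * emeasure \<mu> (cball a (\<alpha> * r))"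
    using a unfolding nondoubling_points_def by blast
  moreover have "diameter (cball a r) \<le> 2 * \<delta>"
    using diameter_cball_le[of r a] r by simp
  ultimately show "\<exists>r. 0 < r \<and> r < e \<and> (a, r) \<in> \<F>\<^sub>A \<mu> \<alpha> C \<delta> A"
    using a by (intro exI[of _ r]) (auto simp: ball_family_def centered_ball_family_def)
qed

theorem corollary3p5:
  fixes \<nu> \<mu> :: "'a::metric_space measure"
    and \<xi> \<eta> \<alpha> \<gamma> \<epsilon>\<^sub>0 \<delta> :: real
    and \<zeta> :: nat
    and A :: "'a set"
  assumes "separable_space (euclidean :: 'a topology)"
    and "0 < \<xi>" and "0 < \<eta>" and "\<eta> \<le> 1 / 3" and "1 \<le> \<zeta>"
    and "directionally_limited_at \<xi> \<eta> \<zeta> (UNIV :: 'a set)"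
    and "0 < \<alpha>" and "\<alpha> \<le> 1" and "1 \<le> \<gamma>"
    and "asymptotically_bounded \<alpha> \<gamma> \<nu>"
    and "borel_measure \<mu>"
    and "0 < \<epsilon>\<^sub>0" and "0 < \<delta>"
  shows "(\<exists>A\<^sub>0 (\<G> :: nat \<Rightarrow> ('a \<times> real) set).
            (\<forall>j\<in>{1..2 * \<zeta> + 1}.
               \<G> j \<subseteq> \<F>\<^sub>A \<mu> \<alpha> (\<gamma> + \<epsilon>\<^sub>0) \<delta> A \<and> countable (\<G> j) \<and>
               disjoint_family_on closed_ball (\<G> j)) \<and>
            A \<subseteq> A\<^sub>0 \<union> (\<Union>j\<in>{1..2 * \<zeta> + 1}. \<Union>B\<in>\<G> j. closed_ball B) \<and>
            outer_measure_of \<mu> A\<^sub>0 = 0)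
       \<and> (outer_measure_of \<mu> A < \<infinity> \<longrightarrow>
            (\<forall>U. open U \<longrightarrow>
               (\<exists>\<G> \<subseteq> \<F>\<^sub>A \<mu> \<alpha> (\<gamma> + \<epsilon>\<^sub>0) \<delta> A.
                  countable \<G> \<and> disjoint_family_on closed_ball \<G> \<and>
                  (\<Union>B\<in>\<G>. closed_ball B) \<subseteq> U \<and>
                  outer_measure_of \<mu> ((A \<inter> U) - (\<Union>B\<in>\<G>. closed_ball B)) = 0)))"
proof (intro conjI impI allI)
  define C where "C = \<gamma> + \<epsilon>\<^sub>0"
  \<comment> \<open>\<open>N\<close> serves as \<open>A\<^sub>0\<close>: it is null because
    \<open>\<gamma> < C\<close>, and off it the family is fine.\<close>
  define N where "N = nondoubling_points \<mu> \<alpha> C"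
  have "\<gamma> < C" using \<open>0 < \<epsilon>\<^sub>0\<close> by (simp add: C_def)
  have null: "outer_measure_of \<mu> N = 0"
    unfolding N_def using assms \<open>\<gamma> < C\<close> by (intro nondoubling_points_null[where \<nu> = \<nu>])
  have fine: "fine_at (\<F>\<^sub>A \<mu> \<alpha> C \<delta> A) (A - N)"
    unfolding N_def using \<open>0 < \<delta>\<close> \<open>0 < \<alpha>\<close> by (rule fine_at_centered_ball_family)
  note sep_dl = \<open>separable_space (euclidean :: 'a topology)\<close>
    \<open>directionally_limited_at \<xi> \<eta> \<zeta> (UNIV :: 'a set)\<close> \<open>\<eta> \<le> 1 / 3\<close> \<open>0 < \<xi>\<close>
  have space: "space \<mu> = UNIV"
    using \<open>borel_measure \<mu>\<close> by (auto simp: borel_measure_def dest: sets_eq_imp_space_eq)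
  obtain \<G> where \<G>: "\<forall>j. \<G> j \<subseteq> \<F>\<^sub>A \<mu> \<alpha> C \<delta> A \<and> countable (\<G> j) \<and> disjoint_family_on closed_ball (\<G> j) \<and>
      (\<Union>B\<in>\<G> j. closed_ball B) \<subseteq> UNIV"
    and cover: "A - N \<subseteq> (\<Union>j\<in>{1..2 * \<zeta> + 1}. \<Union>B\<in>\<G> j. closed_ball B)"
    using fine_cover[OF sep_dl fine open_UNIV] by blast
  show "\<exists>A\<^sub>0 (\<G> :: nat \<Rightarrow> ('a \<times> real) set).
            (\<forall>j\<in>{1..2 * \<zeta> + 1}.
               \<G> j \<subseteq> \<F>\<^sub>A \<mu> \<alpha> (\<gamma> + \<epsilon>\<^sub>0) \<delta> A \<and> countable (\<G> j) \<and>
               disjoint_family_on closed_ball (\<G> j)) \<and>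
            A \<subseteq> A\<^sub>0 \<union> (\<Union>j\<in>{1..2 * \<zeta> + 1}. \<Union>B\<in>\<G> j. closed_ball B) \<and>
            outer_measure_of \<mu> A\<^sub>0 = 0"
  proof (intro exI[of _ N] exI[of _ \<G>] conjI ballI)
    show "A \<subseteq> N \<union> (\<Union>j\<in>{1..2 * \<zeta> + 1}. \<Union>B\<in>\<G> j. closed_ball B)" using cover by blast
  qed (use \<G> null in \<open>simp_all add: C_def\<close>)
  fix U :: "'a set" assume fin: "outer_measure_of \<mu> A < \<infinity>" and "open U"
  \<comment> \<open>The points of \<open>N\<close> are set aside because fineness is known only off
    \<open>N\<close>; subadditivity puts them back at no cost.\<close>
  have "fine_at (\<F>\<^sub>A \<mu> \<alpha> C \<delta> A) (A \<inter> U - N)" using fine by (simp add: fine_at_def)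
  moreover have "outer_measure_of \<mu> (A \<inter> U - N) < \<infinity>"
    using fin by (rule order_le_less_trans[OF outer_measure_of_mono, rotated]) blast
  moreover have "A \<inter> U - N \<subseteq> U" by blast
  ultimately obtain \<H> where \<H>: "\<H> \<subseteq> \<F>\<^sub>A \<mu> \<alpha> C \<delta> A" "countable \<H>" "disjoint_family_on closed_ball \<H>"
    "(\<Union>B\<in>\<H>. closed_ball B) \<subseteq> U" "outer_measure_of \<mu> (A \<inter> U - N - (\<Union>B\<in>\<H>. closed_ball B)) = 0"
    using vitali_covering_fine_family[OF sep_dl \<open>borel_measure \<mu>\<close> _ \<open>open U\<close>] by metis
  have "outer_measure_of \<mu> (A \<inter> U - (\<Union>B\<in>\<H>. closed_ball B)) \<le>
      outer_measure_of \<mu> (N \<union> (A \<inter> U - N - (\<Union>B\<in>\<H>. closed_ball B)))"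
    by (intro outer_measure_of_mono) blast
  also have "\<dots> \<le> outer_measure_of \<mu> N + outer_measure_of \<mu> (A \<inter> U - N - (\<Union>B\<in>\<H>. closed_ball B))"
    by (intro outer_measure_of_Un_le) (auto simp: space)
  finally have "outer_measure_of \<mu> (A \<inter> U - (\<Union>B\<in>\<H>. closed_ball B)) = 0"
    using null \<H>(5) by simp
  with \<H> show "\<exists>\<G> \<subseteq> \<F>\<^sub>A \<mu> \<alpha> (\<gamma> + \<epsilon>\<^sub>0) \<delta> A.
                  countable \<G> \<and> disjoint_family_on closed_ball \<G> \<and>
                  (\<Union>B\<in>\<G>. closed_ball B) \<subseteq> U \<and>
                  outer_measure_of \<mu> ((A \<inter> U) - (\<Union>B\<in>\<G>. closed_ball B)) = 0"
    unfolding C_def by blast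
qed

end
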